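(* (Planning-horizon-variant capital, consumption, and shadow price) Let $0<\alpha<1$, and let $k_T(t)$, $c_T(t)$, $\lambda_T(t)$ be the optimal capital, consumption and shadow price at time $t$ for planning horizon $T$, as in the context. At each time $t$: (i) the capital $k_T(t)$ is monotonically increasing in the length of the planning horizon $T\in[0,\infty)$: $\dfrac{\partial k_T(t)}{\partial T}>0$ for all $t\in[0,T]$; (ii) the consumption $c_T(t)$ is monotonically decreasing in $T$: $\dfrac{\partial c_T(t)}{\partial T}<0$ for all $t\in[0,T]$; (iii) the shadow price $\lambda_T(t)$ is monotonically increasing in $T$: $\dfrac{\partial \lambda_T(t)}{\partial T}>0$ for all $t\in[0,T]$.
   Context: Time $t$ is discrete. For a horizon $T$, consider the problem of maximizing $\sum_{t=0}^{T}\ln c(t)$ subject to $c(t)+k(t+1)=k(t)^\alpha$, $k(0)$ given, $0<k(t)<1$ for $0\le t\le T$, and $k(T+1)=0$. Its unique optimal solution satisfies $k_T(0)=k(0)$, $$k_T(t+1)=\alpha\,\frac{1-\alpha^{T-t}}{1-\alpha^{T-t+1}}\,k_T(t)^\alpha,\qquad c_T(t)=\frac{1-\alpha}{1-\alpha^{T-t+1}}\,k_T(t)^\alpha ,$$ and the shadow price of capital (Lagrange multiplier) is $\lambda_T(t)=1/c_T(t)$. The derivative $\partial/\partial T$ is taken at fixed $t$, regarding these formulas as functions of a real variable $T$.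
   Formalization: Part (i) is proved with strict inequality only for 0 < t ≤ T: at t = 0 the capital k_T(0) = k(0) does not depend on T, so its derivative in T is 0 and the printed strict claim fails; there only weak monotonicity is stated. *)

theory Defs
  imports "HOL-Analysis.Analysis"
begin

(* Maximise the sum of ln c(t) over t = 0, ..., T. The constraint c(t) > 0 is the domain of the
   logarithm in the objective; it must be explicit because ln is total here. *)
definition feasible_plan ::
    "real \<Rightarrow> real \<Rightarrow> nat \<Rightarrow> (nat \<Rightarrow> real) \<Rightarrow> (nat \<Rightarrow> real) \<Rightarrow> bool" where
  "feasible_plan \<alpha> k0 T k c \<longleftrightarrow>
     k 0 = k0 \<and> k (T + 1) = 0 \<and>
     (\<forall>t\<le>T. 0 < k t \<and> k t < 1 \<and> 0 < c t \<and> c t + k (t + 1) = k t powr \<alpha>)"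

definition welfare :: "nat \<Rightarrow> (nat \<Rightarrow> real) \<Rightarrow> real" where
  "welfare T c = (\<Sum>t\<le>T. ln (c t))"

definition optimal_plan ::
    "real \<Rightarrow> real \<Rightarrow> nat \<Rightarrow> (nat \<Rightarrow> real) \<Rightarrow> (nat \<Rightarrow> real) \<Rightarrow> bool" where
  "optimal_plan \<alpha> k0 T k c \<longleftrightarrow>
     feasible_plan \<alpha> k0 T k c \<and>
     (\<forall>k' c'. feasible_plan \<alpha> k0 T k' c' \<longrightarrow> welfare T c' \<le> welfare T c)"

(* For a natural number T these are the unique optimal plan: see optimal_plan_iff below.
   The formulas make sense for every real T > t - 1, which is how the derivative in T at the
   endpoint T = t is to be understood. *)
primrec capital :: "real \<Rightarrow> real \<Rightarrow> real \<Rightarrow> nat \<Rightarrow> real" where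
  "capital \<alpha> k0 T 0 = k0"
| "capital \<alpha> k0 T (Suc t) =
     \<alpha> * ((1 - \<alpha> powr (T - real t)) / (1 - \<alpha> powr (T - real t + 1))) * capital \<alpha> k0 T t powr \<alpha>"

definition consumption :: "real \<Rightarrow> real \<Rightarrow> real \<Rightarrow> nat \<Rightarrow> real" where
  "consumption \<alpha> k0 T t =
     (1 - \<alpha>) / (1 - \<alpha> powr (T - real t + 1)) * capital \<alpha> k0 T t powr \<alpha>"

(* The multiplier of the constraint c(t) + k(t+1) = k(t)^\<alpha>: stationarity of the Lagrangian
   in c(t) gives 1 / c(t); stationarity in k(t+1) is shadow_price_costate below. *)
definition shadow_price :: "real \<Rightarrow> real \<Rightarrow> real \<Rightarrow> nat \<Rightarrow> real" where
  "shadow_price \<alpha> k0 T t = 1 / consumption \<alpha> k0 T t"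

lemma one_minus_powr_pos:
  fixes \<alpha> x :: real
  assumes "0 < \<alpha>" "\<alpha> < 1" "0 < x"
  shows "0 < 1 - \<alpha> powr x"
  using assms powr01_less_one[of \<alpha> x] by simp

lemma capital_bounds:
  assumes a: "0 < \<alpha>" "\<alpha> < 1" and k0: "0 < k0" "k0 < 1" and t: "real t \<le> T"
  shows "0 < capital \<alpha> k0 T t \<and> capital \<alpha> k0 T t < 1"
  using t
proof (induction t)
  case 0
  then show ?case using k0 by simp
next
  case (Suc t)
  let ?x = "T - real t" and ?K = "capital \<alpha> k0 T t"
  have K: "0 < ?K" "?K < 1" using Suc by auto
  have p: "0 < 1 - \<alpha> powr ?x" "0 < 1 - \<alpha> powr (?x + 1)"
    using one_minus_powr_pos[OF a] Suc.prems by auto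
  have e: "\<alpha> powr (?x + 1) = \<alpha> * \<alpha> powr ?x" using a by (simp add: powr_add)
  have f: "0 < \<alpha> * ((1 - \<alpha> powr ?x) / (1 - \<alpha> powr (?x + 1)))"
    using a p by simp
  have g: "\<alpha> * ((1 - \<alpha> powr ?x) / (1 - \<alpha> powr (?x + 1))) < 1"
    using a p unfolding e by (simp add: field_simps)
  have h: "0 < ?K powr \<alpha>" "?K powr \<alpha> < 1"
    using K a powr01_less_one[of ?K \<alpha>] by auto
  have "\<alpha> * ((1 - \<alpha> powr ?x) / (1 - \<alpha> powr (?x + 1))) * ?K powr \<alpha> < 1 * 1"
    by (rule mult_strict_mono) (use f g h in auto)
  then show ?case using mult_pos_pos[OF f h(1)] by (simp only: capital.simps mult_1_right simp_thms)
qed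

lemma consumption_pos:
  assumes "0 < \<alpha>" "\<alpha> < 1" "0 < k0" "k0 < 1" "real t \<le> T"
  shows "0 < consumption \<alpha> k0 T t"
  using capital_bounds[OF assms] one_minus_powr_pos[of \<alpha> "T - real t + 1"] assms
  by (simp add: consumption_def)

lemma resource_constraint:
  assumes a: "0 < \<alpha>" "\<alpha> < 1" and t: "real t \<le> T"
  shows "consumption \<alpha> k0 T t + capital \<alpha> k0 T (Suc t) = capital \<alpha> k0 T t powr \<alpha>"
proof -
  let ?x = "T - real t"
  have p: "1 - \<alpha> powr (?x + 1) \<noteq> 0"
    using one_minus_powr_pos[OF a, of "?x + 1"] t by auto
  have e: "\<alpha> powr (?x + 1) = \<alpha> * \<alpha> powr ?x" using a by (simp add: powr_add)
  have "(1 - \<alpha>) / (1 - \<alpha> powr (?x + 1)) + \<alpha> * ((1 - \<alpha> powr ?x) / (1 - \<alpha> powr (?x + 1))) = 1"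
    using p unfolding e by (simp add: add_divide_distrib[symmetric] right_diff_distrib)
  then show ?thesis
    by (simp only: consumption_def capital.simps ring_distribs(2)[symmetric])
qed

lemma shadow_price_costate:
  assumes a: "0 < \<alpha>" "\<alpha> < 1" and k0: "0 < k0" "k0 < 1" and t: "real (Suc t) \<le> T"
  shows "shadow_price \<alpha> k0 T t =
           shadow_price \<alpha> k0 T (Suc t) * (\<alpha> * capital \<alpha> k0 T (Suc t) powr (\<alpha> - 1))"
proof -
  let ?K = "capital \<alpha> k0 T t" and ?L = "capital \<alpha> k0 T (Suc t)"
  define u where "u = 1 - \<alpha> powr (T - real t)"
  define v where "v = 1 - \<alpha> powr (T - real t + 1)"
  have K: "0 < ?K" and L: "0 < ?L"
    using capital_bounds[OF a k0, of t T] capital_bounds[OF a k0 t] t by auto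
  have uv: "0 < u" "0 < v"
    using one_minus_powr_pos[OF a] t by (auto simp: u_def v_def)
  have C: "consumption \<alpha> k0 T t = (1 - \<alpha>) / v * ?K powr \<alpha>"
    by (simp add: consumption_def v_def)
  have C': "consumption \<alpha> k0 T (Suc t) = (1 - \<alpha>) / u * ?L powr \<alpha>"
    by (simp add: consumption_def u_def del: capital.simps)
  have L': "?L = \<alpha> * (u / v) * ?K powr \<alpha>"
    by (simp add: u_def v_def)
  have La: "?L powr (\<alpha> - 1) = ?L powr \<alpha> / ?L" using powr_diff[of ?L \<alpha> 1] L by (simp del: capital.simps)
  have Kp: "0 < ?K powr \<alpha>" and Lp: "0 < ?L powr \<alpha>" using K L by auto
  have "shadow_price \<alpha> k0 T (Suc t) * (\<alpha> * ?L powr (\<alpha> - 1)) = u * \<alpha> / ((1 - \<alpha>) * ?L)"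
    unfolding shadow_price_def C' La using Lp by (simp del: capital.simps)
  also have "\<dots> = v / ((1 - \<alpha>) * ?K powr \<alpha>)"
    unfolding L' using uv Kp a by (simp add: field_simps)
  also have "\<dots> = shadow_price \<alpha> k0 T t"
    unfolding shadow_price_def C by simp
  finally show ?thesis by simp
qed

lemma powr_below_tangent:
  fixes \<alpha> x y :: real
  assumes a: "0 < \<alpha>" "\<alpha> < 1" and "0 < x" "0 < y"
  shows "x powr \<alpha> \<le> y powr \<alpha> + \<alpha> * y powr (\<alpha> - 1) * (x - y)"
proof -
  have "(x / y) powr \<alpha> * 1 powr (1 - \<alpha>) \<le> \<alpha> * (x / y) + (1 - \<alpha>) * 1"
    using assms by (intro Youngs_inequality_0) auto
  then have "(x / y) powr \<alpha> * y powr \<alpha> \<le> (\<alpha> * (x / y) + (1 - \<alpha>)) * y powr \<alpha>"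
    by (intro mult_right_mono) auto
  then show ?thesis
    using assms by (simp add: powr_divide powr_diff field_simps)
qed

lemma feasible_optimal_paths:
  assumes a: "0 < \<alpha>" "\<alpha> < 1" and k0: "0 < k0" "k0 < 1"
  shows "feasible_plan \<alpha> k0 T (capital \<alpha> k0 (real T)) (consumption \<alpha> k0 (real T))"
  using capital_bounds[OF a k0] consumption_pos[OF a k0] resource_constraint[OF a] a
  by (auto simp: feasible_plan_def simp del: capital.simps(2)) simp

lemma feasible_plan_gap:
  assumes a: "0 < \<alpha>" "\<alpha> < 1" and k0: "0 < k0" "k0 < 1"
    and f: "feasible_plan \<alpha> k0 T k c" and n: "n \<le> T"
  shows "(\<Sum>t\<le>n. (c t - consumption \<alpha> k0 T t) * shadow_price \<alpha> k0 T t)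
           \<le> - shadow_price \<alpha> k0 T n * (k (Suc n) - capital \<alpha> k0 T (Suc n))"
  using n
proof (induction n)
  case 0
  have "c 0 + k (Suc 0) = k0 powr \<alpha>" using f by (auto simp: feasible_plan_def)
  moreover have "consumption \<alpha> k0 T 0 + capital \<alpha> k0 T (Suc 0) = k0 powr \<alpha>"
    using resource_constraint[OF a, of 0 T k0] by simp
  ultimately have "c 0 - consumption \<alpha> k0 T 0 = - (k (Suc 0) - capital \<alpha> k0 T (Suc 0))"
    by linarith
  then have "(c 0 - consumption \<alpha> k0 T 0) * shadow_price \<alpha> k0 T 0
      = - shadow_price \<alpha> k0 T 0 * (k (Suc 0) - capital \<alpha> k0 T (Suc 0))"
    by (simp only: mult_minus_left mult.commute)
  then show ?case by (simp only: atMost_0 sum.insert finite.emptyI empty_iff sum.empty simp_thms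
        add_0_right order.refl)
next
  case (Suc n)
  let ?S = "shadow_price \<alpha> k0 T" and ?K = "capital \<alpha> k0 T" and ?C = "consumption \<alpha> k0 T"
  have S: "0 < ?S (Suc n)"
    using consumption_pos[OF a k0, of "Suc n" T] Suc.prems by (simp add: shadow_price_def)
  have K: "0 < ?K (Suc n)" using capital_bounds[OF a k0, of "Suc n" T] Suc.prems by auto
  have k: "0 < k (Suc n)" "c (Suc n) + k (Suc (Suc n)) = k (Suc n) powr \<alpha>"
    using f Suc.prems by (auto simp: feasible_plan_def)
  have r: "?C (Suc n) + ?K (Suc (Suc n)) = ?K (Suc n) powr \<alpha>"
    using Suc.prems by (intro resource_constraint[OF a]) simp
  have "c (Suc n) - ?C (Suc n) \<le> \<alpha> * ?K (Suc n) powr (\<alpha> - 1) * (k (Suc n) - ?K (Suc n))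
          - (k (Suc (Suc n)) - ?K (Suc (Suc n)))"
    using powr_below_tangent[OF a k(1) K] k(2) r by linarith
  then have "(c (Suc n) - ?C (Suc n)) * ?S (Suc n)
      \<le> (\<alpha> * ?K (Suc n) powr (\<alpha> - 1) * (k (Suc n) - ?K (Suc n))
          - (k (Suc (Suc n)) - ?K (Suc (Suc n)))) * ?S (Suc n)"
    using S by (intro mult_right_mono) auto
  also have "\<dots> = ?S (Suc n) * (\<alpha> * ?K (Suc n) powr (\<alpha> - 1)) * (k (Suc n) - ?K (Suc n))
          - ?S (Suc n) * (k (Suc (Suc n)) - ?K (Suc (Suc n)))"
    by (simp only: algebra_simps)
  also have "?S (Suc n) * (\<alpha> * ?K (Suc n) powr (\<alpha> - 1)) = ?S n"
    using Suc.prems by (intro shadow_price_costate[OF a k0, symmetric]) simp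
  finally have "(c (Suc n) - ?C (Suc n)) * ?S (Suc n)
      \<le> ?S n * (k (Suc n) - ?K (Suc n)) - ?S (Suc n) * (k (Suc (Suc n)) - ?K (Suc (Suc n)))" .
  moreover have "(\<Sum>t\<le>n. (c t - ?C t) * ?S t) \<le> - ?S n * (k (Suc n) - ?K (Suc n))"
    using Suc by simp
  ultimately show ?case by (simp del: capital.simps)
qed

lemma welfare_le:
  assumes a: "0 < \<alpha>" "\<alpha> < 1" and k0: "0 < k0" "k0 < 1"
    and f: "feasible_plan \<alpha> k0 T k c"
  shows "welfare T c \<le> welfare T (consumption \<alpha> k0 T)"
    and "welfare T c = welfare T (consumption \<alpha> k0 T) \<Longrightarrow> t \<le> T \<Longrightarrow> c t = consumption \<alpha> k0 T t"
proof -
  let ?S = "shadow_price \<alpha> k0 T" and ?C = "consumption \<alpha> k0 T"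
  define d where "d t = (c t - ?C t) * ?S t - (ln (c t) - ln (?C t))" for t
  have pos: "0 < c t" "0 < ?C t" if "t \<le> T" for t
    using f consumption_pos[OF a k0, of t T] that by (auto simp: feasible_plan_def)
  have d: "d t = (c t / ?C t - 1) - ln (c t / ?C t)" if "t \<le> T" for t
    using pos[OF that] by (simp add: d_def shadow_price_def ln_div field_simps)
  have d0: "0 \<le> d t" if "t \<le> T" for t
    using ln_le_minus_one[of "c t / ?C t"] pos[OF that] d[OF that] by simp
  have "k (Suc T) = 0" using f by (simp add: feasible_plan_def)
  moreover have "capital \<alpha> k0 T (Suc T) = 0" using a by simp
  ultimately have "(\<Sum>t\<le>T. (c t - ?C t) * ?S t) \<le> 0"
    using feasible_plan_gap[OF a k0 f, of T] by (simp del: capital.simps)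
  then have le: "(\<Sum>t\<le>T. d t) \<le> welfare T ?C - welfare T c"
    by (simp add: d_def welfare_def sum_subtractf)
  have ge: "0 \<le> (\<Sum>t\<le>T. d t)" using d0 by (intro sum_nonneg) auto
  show "welfare T c \<le> welfare T ?C" using le ge by linarith
  assume "welfare T c = welfare T ?C" and t: "t \<le> T"
  then have "(\<Sum>t\<le>T. d t) = 0" using le ge by linarith
  then have "d t = 0" using d0 t by (subst (asm) sum_nonneg_eq_0_iff) auto
  then have "ln (c t / ?C t) = c t / ?C t - 1" using d[OF t] by simp
  then have "c t / ?C t = 1" using pos[OF t] by (intro ln_eq_minus_one) auto
  then show "c t = ?C t" using pos[OF t] by simp
qed

theorem optimal_plan_iff:
  assumes a: "0 < \<alpha>" "\<alpha> < 1" and k0: "0 < k0" "k0 < 1"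
  shows "optimal_plan \<alpha> k0 T k c \<longleftrightarrow>
           (\<forall>t\<le>T + 1. k t = capital \<alpha> k0 (real T) t) \<and>
           (\<forall>t\<le>T. c t = consumption \<alpha> k0 (real T) t)"
    (is "_ \<longleftrightarrow> ?R")
proof
  let ?K = "capital \<alpha> k0 (real T)" and ?C = "consumption \<alpha> k0 (real T)"
  assume o: "optimal_plan \<alpha> k0 T k c"
  then have f: "feasible_plan \<alpha> k0 T k c" by (simp add: optimal_plan_def)
  have "welfare T ?C \<le> welfare T c"
    using o feasible_optimal_paths[OF a k0] by (auto simp: optimal_plan_def)
  then have w: "welfare T c = welfare T ?C" using welfare_le(1)[OF a k0 f] by simp
  have c: "c t = ?C t" if "t \<le> T" for t using welfare_le(2)[OF a k0 f w that] .
  have "k t = ?K t" if "t \<le> T + 1" for t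
    using that
  proof (induction t)
    case 0
    then show ?case using f by (simp add: feasible_plan_def)
  next
    case (Suc t)
    then have "c t + k (Suc t) = k t powr \<alpha>" using f by (simp add: feasible_plan_def)
    moreover have "?C t + ?K (Suc t) = ?K t powr \<alpha>"
      using Suc.prems by (intro resource_constraint[OF a]) simp
    ultimately show ?case using Suc c[of t] by simp
  qed
  then show ?R using c by blast
next
  let ?K = "capital \<alpha> k0 (real T)" and ?C = "consumption \<alpha> k0 (real T)"
  assume r: ?R
  have "feasible_plan \<alpha> k0 T k c \<longleftrightarrow> feasible_plan \<alpha> k0 T ?K ?C"
    using r by (simp add: feasible_plan_def del: capital.simps)
  moreover have "welfare T c = welfare T ?C"
    using r by (simp add: welfare_def)
  ultimately show "optimal_plan \<alpha> k0 T k c"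
    using feasible_optimal_paths[OF a k0] welfare_le(1)[OF a k0] by (simp add: optimal_plan_def)
qed

(* So the derivative of capital in T can be strictly positive only for t > 0. *)
lemma capital_initial_deriv:
  "((\<lambda>T. capital \<alpha> k0 T 0) has_real_derivative D) (at T) \<longleftrightarrow> D = 0"
  by (auto dest: DERIV_unique[OF DERIV_const])

end

(* Work with logarithmic derivatives in T. That of 1 - \<alpha> powr (T - s) is the decreasing
   function r(x) = horizon_rate \<alpha> x at x = T - s, so the logarithmic derivative L_t of capital
   satisfies L_0 = 0 and L_{t+1} = r(T-t) - r(T-t+1) + \<alpha> L_t. Hence L_t > 0 for t > 0, and
   the recursion telescopes to L_t < r(T-t+1). As consumption has logarithmic derivative
   \<alpha> L_t - r(T-t+1), it decreases. *)
theory Submission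
  imports Defs
begin

text \<open>Writing a derivative as value times rate lets rates add under products, and in the two
  lemmas below subtract under quotients and scale by the exponent under powers.\<close>

lemma log_derivative_mult:
  fixes f g :: "real \<Rightarrow> real"
  assumes "(f has_real_derivative f x * a) (at x)" "(g has_real_derivative g x * b) (at x)"
  shows "((\<lambda>x. f x * g x) has_real_derivative f x * g x * (a + b)) (at x)"
  by (rule DERIV_cong[OF DERIV_mult[OF assms]]) (simp add: algebra_simps)

lemma log_derivative_divide:
  fixes f g :: "real \<Rightarrow> real"
  assumes "(f has_real_derivative f x * a) (at x)" "(g has_real_derivative g x * b) (at x)"
    and "g x \<noteq> 0"
  shows "((\<lambda>x. f x / g x) has_real_derivative f x / g x * (a - b)) (at x)"
  by (rule DERIV_cong[OF DERIV_divide[OF assms]]) (use assms(3) in \<open>simp add: field_simps\<close>)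

lemma log_derivative_powr:
  fixes f :: "real \<Rightarrow> real"
  assumes "(f has_real_derivative f x * a) (at x)" "0 < f x"
  shows "((\<lambda>x. f x powr p) has_real_derivative f x powr p * (p * a)) (at x)"
  by (rule DERIV_cong[OF DERIV_fun_powr[OF assms]])
     (use assms(2) in \<open>simp add: powr_diff\<close>)

text \<open>The factor \<open>- ln \<alpha>\<close> is positive for \<alpha> < 1, so sign and
  monotonicity can be read off the quotient.\<close>

definition horizon_rate :: "real \<Rightarrow> real \<Rightarrow> real" where
  "horizon_rate \<alpha> x = - ln \<alpha> * (\<alpha> powr x / (1 - \<alpha> powr x))"

text \<open>The exponent is a general \<open>u\<close> of slope 1 so that one rule serves both
  \<open>T - real t\<close> and \<open>T - real t + 1\<close>.\<close>

lemma log_derivative_one_minus_powr: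
  assumes a: "0 < \<alpha>" "\<alpha> < 1" and u: "(u has_real_derivative 1) (at T)" "0 < u T"
  shows "((\<lambda>T. 1 - \<alpha> powr u T) has_real_derivative
           (1 - \<alpha> powr u T) * horizon_rate \<alpha> (u T)) (at T)"
proof -
  have "((\<lambda>T. 1 - \<alpha> powr u T) has_real_derivative - (\<alpha> powr u T * ln \<alpha>)) (at T)"
    using DERIV_diff[OF DERIV_const[of 1] DERIV_powr[OF DERIV_const[of \<alpha>] a(1) u(1)]] by simp
  then show ?thesis
    using one_minus_powr_pos[OF a u(2)] by (simp add: horizon_rate_def mult.commute)
qed

lemma horizon_rate_pos:
  assumes "0 < \<alpha>" "\<alpha> < 1" "0 < x"
  shows "0 < horizon_rate \<alpha> x"
  using assms one_minus_powr_pos[OF assms] unfolding horizon_rate_def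
  by (intro mult_pos_pos divide_pos_pos) auto

text \<open>The map p / (1 - p) increases on (0, 1), while \<open>\<alpha> powr x\<close> decreases
  in x because \<alpha> < 1.\<close>

lemma horizon_rate_strict_antimono:
  assumes a: "0 < \<alpha>" "\<alpha> < 1" and x: "0 < x" "x < y"
  shows "horizon_rate \<alpha> y < horizon_rate \<alpha> x"
proof -
  have "\<alpha> powr y < \<alpha> powr x" using a x by (simp add: powr_less_mono')
  then have "\<alpha> powr y / (1 - \<alpha> powr y) < \<alpha> powr x / (1 - \<alpha> powr x)"
    using one_minus_powr_pos[OF a, of x] one_minus_powr_pos[OF a, of y] x
    by (simp add: field_simps)
  then show ?thesis
    using a unfolding horizon_rate_def by (intro mult_strict_left_mono) auto
qed

lemma capital_log_derivative:
  assumes a: "0 < \<alpha>" "\<alpha> < 1" and k0: "0 < k0" "k0 < 1" and t: "real t \<le> T"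
  shows "\<exists>L. ((\<lambda>T. capital \<alpha> k0 T t) has_real_derivative capital \<alpha> k0 T t * L) (at T) \<and>
             0 \<le> L \<and> (0 < t \<longrightarrow> 0 < L) \<and> L < horizon_rate \<alpha> (T - real t + 1)"
  using t
proof (induction t)
  case 0
  \<comment> \<open>Initial capital does not depend on T, so its rate is 0.\<close>
  then show ?case using horizon_rate_pos[OF a] by (intro exI[of _ 0]) auto
next
  case (Suc t)
  let ?K = "\<lambda>T. capital \<alpha> k0 T t" and ?x = "T - real t"
  let ?g = "\<lambda>T. (1 - \<alpha> powr (T - real t)) / (1 - \<alpha> powr (T - real t + 1))"
  \<comment> \<open>Since \<open>Suc t \<le> T\<close>, even the endpoint \<open>T = Suc t\<close>
    leaves the numerator of \<open>?g\<close> positive, so its rate is defined there.\<close>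
  have x: "0 < ?x" using Suc.prems by simp
  from Suc obtain L where L: "(?K has_real_derivative ?K T * L) (at T)"
      "0 \<le> L" "L < horizon_rate \<alpha> (?x + 1)" by auto
  define r where "r = horizon_rate \<alpha> ?x - horizon_rate \<alpha> (?x + 1)"
  have r: "0 < r" using horizon_rate_strict_antimono[OF a x, of "?x + 1"] by (simp add: r_def)
  have K: "0 < ?K T" using capital_bounds[OF a k0] Suc.prems by auto
  have "(?g has_real_derivative ?g T * r) (at T)"
    using one_minus_powr_pos[OF a, of "?x + 1"] x unfolding r_def
    by (intro log_derivative_divide log_derivative_one_minus_powr[OF a])
       (auto intro!: derivative_eq_intros)
  then have "((\<lambda>T. \<alpha> * (?g T * ?K T powr \<alpha>)) has_real_derivative
      \<alpha> * (?g T * ?K T powr \<alpha> * (r + \<alpha> * L))) (at T)"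
    by (intro DERIV_cmult log_derivative_mult log_derivative_powr L K)
  then have "((\<lambda>T. capital \<alpha> k0 T (Suc t)) has_real_derivative
      capital \<alpha> k0 T (Suc t) * (r + \<alpha> * L)) (at T)"
    by (simp add: mult.assoc)
  \<comment> \<open>Thus \<open>\<alpha> * L\<close> stays below
    \<open>horizon_rate \<alpha> (?x + 1)\<close>, the term subtracted in \<open>r\<close>, and the
    sum stays below \<open>horizon_rate \<alpha> ?x\<close>.\<close>
  moreover have "0 \<le> \<alpha> * L" "\<alpha> * L \<le> L" using a L(2) by (auto simp: mult_left_le_one_le)
  then have "0 < r + \<alpha> * L" "r + \<alpha> * L < horizon_rate \<alpha> ?x"
    using r L(3) by (auto simp: r_def)
  ultimately show ?case by (intro exI[of _ "r + \<alpha> * L"]) simp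
qed

lemma capital_deriv_pos:
  assumes "0 < \<alpha>" "\<alpha> < 1" "0 < k0" "k0 < 1" "real t \<le> T" "0 < t"
  shows "\<exists>D. ((\<lambda>T. capital \<alpha> k0 T t) has_real_derivative D) (at T) \<and> D > 0"
  using capital_log_derivative[OF assms(1-5)] capital_bounds[OF assms(1-5)] assms(6)
    mult_pos_pos by blast

lemma consumption_deriv_neg:
  assumes a: "0 < \<alpha>" "\<alpha> < 1" and k0: "0 < k0" "k0 < 1" and t: "real t \<le> T"
  shows "\<exists>D. ((\<lambda>T. consumption \<alpha> k0 T t) has_real_derivative D) (at T) \<and> D < 0"
proof -
  let ?K = "\<lambda>T. capital \<alpha> k0 T t" and ?C = "\<lambda>T. consumption \<alpha> k0 T t"
  let ?r = "horizon_rate \<alpha> (T - real t + 1)"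
  obtain L where L: "(?K has_real_derivative ?K T * L) (at T)" "0 \<le> L" "L < ?r"
    using capital_log_derivative[OF assms] by blast
  have K: "0 < ?K T" using capital_bounds[OF assms] by simp
  \<comment> \<open>This is the consumed share of output. The 0 is the rate of its constant
    numerator.\<close>
  have "((\<lambda>T. (1 - \<alpha>) / (1 - \<alpha> powr (T - real t + 1))) has_real_derivative
          (1 - \<alpha>) / (1 - \<alpha> powr (T - real t + 1)) * (0 - ?r)) (at T)"
    using one_minus_powr_pos[OF a, of "T - real t + 1"] t
    by (intro log_derivative_divide log_derivative_one_minus_powr[OF a])
       (auto intro!: derivative_eq_intros)
  then have "(?C has_real_derivative ?C T * (0 - ?r + \<alpha> * L)) (at T)"
    unfolding consumption_def by (intro log_derivative_mult log_derivative_powr L K)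
  \<comment> \<open>Output grows at rate \<open>\<alpha> * L\<close>, more slowly than the consumed
    share falls.\<close>
  moreover have "\<alpha> * L \<le> L" using a L(2) by (auto simp: mult_left_le_one_le)
  then have "?C T * (0 - ?r + \<alpha> * L) < 0"
    using L(3) consumption_pos[OF assms] by (intro mult_pos_neg) auto
  ultimately show ?thesis by blast
qed

lemma shadow_price_deriv_pos:
  assumes "0 < \<alpha>" "\<alpha> < 1" "0 < k0" "k0 < 1" "real t \<le> T"
  shows "\<exists>D. ((\<lambda>T. shadow_price \<alpha> k0 T t) has_real_derivative D) (at T) \<and> D > 0"
proof -
  let ?C = "\<lambda>T. consumption \<alpha> k0 T t"
  obtain D where D: "(?C has_real_derivative D) (at T)" "D < 0"
    using consumption_deriv_neg[OF assms] by blast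
  have C: "0 < ?C T" using consumption_pos[OF assms] .
  have "((\<lambda>T. shadow_price \<alpha> k0 T t) has_real_derivative - D / (?C T * ?C T)) (at T)"
    unfolding shadow_price_def using DERIV_divide[OF DERIV_const[of 1] D(1)] C by simp
  moreover have "0 < - D / (?C T * ?C T)" using D(2) C by (intro divide_pos_pos) auto
  ultimately show ?thesis by blast
qed

text \<open>Any [x, y] with a \<le> x lies in the ray, so the mean value theorem applies on it. The
  derivative is two-sided even at \<open>a\<close>.\<close>

lemma strict_mono_on_atLeast_if_deriv_pos:
  fixes f :: "real \<Rightarrow> real"
  assumes "\<And>x. a \<le> x \<Longrightarrow> \<exists>D. (f has_real_derivative D) (at x) \<and> D > 0"
  shows "strict_mono_on {a..} f"
proof (rule strict_mono_onI)
  fix x y assume "x \<in> {a..}" "y \<in> {a..}" "x < y"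
  then show "f x < f y" using assms by (intro DERIV_pos_imp_increasing[of x y f]) auto
qed

lemma strict_antimono_on_atLeast_if_deriv_neg:
  fixes f :: "real \<Rightarrow> real"
  assumes "\<And>x. a \<le> x \<Longrightarrow> \<exists>D. (f has_real_derivative D) (at x) \<and> D < 0"
  shows "strict_antimono_on {a..} f"
proof (rule monotone_onI)
  fix x y assume "x \<in> {a..}" "y \<in> {a..}" "x < y"
  then show "f x > f y" using assms by (intro DERIV_neg_imp_decreasing[of x y f]) auto
qed

text \<open>Strictness for capital needs t > 0, because \<open>k0\<close> is given. The ray
  \<open>{real t..}\<close> collects the real horizons that reach time t.\<close>

theorem proposition4:
  fixes \<alpha> k0 :: real and t :: nat
  assumes "0 < \<alpha>" and "\<alpha> < 1" and "0 < k0" and "k0 < 1"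
  shows
    "(mono_on {real t..} (\<lambda>T. capital \<alpha> k0 T t) \<and>
      (0 < t \<longrightarrow>
        strict_mono_on {real t..} (\<lambda>T. capital \<alpha> k0 T t) \<and>
        (\<forall>T\<ge>real t. \<exists>D. ((\<lambda>T. capital \<alpha> k0 T t) has_real_derivative D) (at T) \<and> D > 0))) \<and>
     (strict_antimono_on {real t..} (\<lambda>T. consumption \<alpha> k0 T t) \<and>
      (\<forall>T\<ge>real t. \<exists>D. ((\<lambda>T. consumption \<alpha> k0 T t) has_real_derivative D) (at T) \<and> D < 0)) \<and>
     (strict_mono_on {real t..} (\<lambda>T. shadow_price \<alpha> k0 T t) \<and>
      (\<forall>T\<ge>real t. \<exists>D. ((\<lambda>T. shadow_price \<alpha> k0 T t) has_real_derivative D) (at T) \<and> D > 0))"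
proof -
  have K: "strict_mono_on {real t..} (\<lambda>T. capital \<alpha> k0 T t)" if "0 < t"
    using capital_deriv_pos[OF assms _ that] by (rule strict_mono_on_atLeast_if_deriv_pos)
  moreover have "mono_on {real t..} (\<lambda>T. capital \<alpha> k0 T t)"
    \<comment> \<open>For t = 0 the function of T is constant; otherwise strict monotonicity implies
      the weak form.\<close>
    by (cases "t = 0") (auto simp: mono_on_def intro!: strict_mono_on_leD[OF K])
  moreover have "strict_antimono_on {real t..} (\<lambda>T. consumption \<alpha> k0 T t)"
    using consumption_deriv_neg[OF assms] by (rule strict_antimono_on_atLeast_if_deriv_neg)
  moreover have "strict_mono_on {real t..} (\<lambda>T. shadow_price \<alpha> k0 T t)"
    using shadow_price_deriv_pos[OF assms] by (rule strict_mono_on_atLeast_if_deriv_pos)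
  ultimately show ?thesis
    using capital_deriv_pos[OF assms] consumption_deriv_neg[OF assms]
      shadow_price_deriv_pos[OF assms] by blast
qed

end
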